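(* Let $S$ be an intra-regular $\Gamma$-AG$^{\ast\ast}$-groupoid and let $A=(\mu_A,\gamma_A)$ be an intuitionistic fuzzy set of $S$. Then the following conditions are equivalent. (i) $A$ is an intuitionistic fuzzy $\Gamma$-quasi ideal of $S$. (ii) $(A\circ_\Gamma\delta)\cap(\delta\circ_\Gamma A)=A$, where $\delta=(S_\delta,\Theta_\delta)$.
   Context: Let $S,\Gamma$ be nonempty sets with a map $S\times\Gamma\times S\to S$, $(x,\alpha,y)\mapsto x\alpha y$. $S$ is a $\Gamma$-AG-groupoid if $(x\alpha y)\beta z=(z\alpha y)\beta x$ for all $x,y,z\in S$, $\alpha,\beta\in\Gamma$. It is a $\Gamma$-AG$^{\ast\ast}$-groupoid if moreover $x\alpha(y\beta z)=y\alpha(x\beta z)$ for all $x,y,z\in S$, $\alpha,\beta\in\Gamma$. $S$ is intra-regular if for every $a\in S$ there exist $x,y\in S$ and $\alpha,\beta,\gamma\in\Gamma$ with $a=(x\alpha(a\beta a))\gamma y$. An intuitionistic fuzzy set (IFS) of $S$ is a pair $A=(\mu_A,\gamma_A)$ of functions $\mu_A,\gamma_A:S\to[0,1]$ with $0\le\mu_A(x)+\gamma_A(x)\le1$ for all $x\in S$. Let $\delta=(S_\delta,\Theta_\delta)$ be the IFS with $S_\delta(x)=1$, $\Theta_\delta(x)=0$ for all $x$. $A\subseteq B$ means $\mu_A(x)\le\mu_B(x)$ and $\gamma_A(x)\ge\gamma_B(x)$ for all $x$. $A\cap B$ is the IFS $(\min(\mu_A,\mu_B),\max(\gamma_A,\gamma_B))$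 (pointwise). The product $A\circ_\Gamma B=(\mu_A\circ_\Gamma\mu_B,\gamma_A\circ_\Gamma\gamma_B)$ is given by $(\mu_A\circ_\Gamma\mu_B)(a)=\sup\{\mu_A(b)\wedge\mu_B(c)\}$ and $(\gamma_A\circ_\Gamma\gamma_B)(a)=\inf\{\gamma_A(b)\vee\gamma_B(c)\}$, over all $b,c\in S$, $\beta\in\Gamma$ with $a=b\beta c$, if such a factorization exists, and by $0$ and $1$ respectively otherwise. Here $\wedge=\min$, $\vee=\max$. An IFS $A$ of $S$ is an intuitionistic fuzzy $\Gamma$-quasi ideal if $(A\circ_\Gamma\delta)\cap(\delta\circ_\Gamma A)\subseteq A$. *)

theory Defs
  imports Complex_Main
begin

locale gamma_AG_groupoid =
  fixes S :: "'a set" and \<Gamma> :: "'g set" and m :: "'a \<Rightarrow> 'g \<Rightarrow> 'a \<Rightarrow> 'a"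
  assumes S_nonempty: "S \<noteq> {}"
    and Gamma_nonempty: "\<Gamma> \<noteq> {}"
    and closed: "\<lbrakk>x \<in> S; \<alpha> \<in> \<Gamma>; y \<in> S\<rbrakk> \<Longrightarrow> m x \<alpha> y \<in> S"
    and left_invertive: "\<lbrakk>x \<in> S; y \<in> S; z \<in> S; \<alpha> \<in> \<Gamma>; \<beta> \<in> \<Gamma>\<rbrakk>
      \<Longrightarrow> m (m x \<alpha> y) \<beta> z = m (m z \<alpha> y) \<beta> x"

locale gamma_AG_star_star_groupoid = gamma_AG_groupoid +
  assumes star_star: "\<lbrakk>x \<in> S; y \<in> S; z \<in> S; \<alpha> \<in> \<Gamma>; \<beta> \<in> \<Gamma>\<rbrakk>
      \<Longrightarrow> m x \<alpha> (m y \<beta> z) = m y \<alpha> (m x \<beta> z)"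

definition intra_regular :: "'a set \<Rightarrow> 'g set \<Rightarrow> ('a \<Rightarrow> 'g \<Rightarrow> 'a \<Rightarrow> 'a) \<Rightarrow> bool" where
  "intra_regular S \<Gamma> m \<longleftrightarrow>
    (\<forall>a\<in>S. \<exists>x\<in>S. \<exists>y\<in>S. \<exists>\<alpha>\<in>\<Gamma>. \<exists>\<beta>\<in>\<Gamma>. \<exists>\<gamma>\<in>\<Gamma>. a = m (m x \<alpha> (m a \<beta> a)) \<gamma> y)"

(* A pair (membership, non-membership). Only the values on the carrier S are meaningful,
   so inclusion and equality below are relative to S. *)
type_synonym 'a ifs = "('a \<Rightarrow> real) \<times> ('a \<Rightarrow> real)"

definition is_ifs :: "'a set \<Rightarrow> 'a ifs \<Rightarrow> bool" where
  "is_ifs S A \<longleftrightarrow>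
    (\<forall>x\<in>S. fst A x \<in> {0..1} \<and> snd A x \<in> {0..1} \<and>
      0 \<le> fst A x + snd A x \<and> fst A x + snd A x \<le> 1)"

definition ifs_delta :: "'a ifs" where
  "ifs_delta = ((\<lambda>x. 1), (\<lambda>x. 0))"

definition ifs_subset :: "'a set \<Rightarrow> 'a ifs \<Rightarrow> 'a ifs \<Rightarrow> bool" where
  "ifs_subset S A B \<longleftrightarrow> (\<forall>x\<in>S. fst A x \<le> fst B x \<and> snd A x \<ge> snd B x)"

definition ifs_eq :: "'a set \<Rightarrow> 'a ifs \<Rightarrow> 'a ifs \<Rightarrow> bool" where
  "ifs_eq S A B \<longleftrightarrow> (\<forall>x\<in>S. fst A x = fst B x \<and> snd A x = snd B x)"

definition ifs_inter :: "'a ifs \<Rightarrow> 'a ifs \<Rightarrow> 'a ifs" where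
  "ifs_inter A B = ((\<lambda>x. min (fst A x) (fst B x)), (\<lambda>x. max (snd A x) (snd B x)))"

definition factorizations ::
    "'a set \<Rightarrow> 'g set \<Rightarrow> ('a \<Rightarrow> 'g \<Rightarrow> 'a \<Rightarrow> 'a) \<Rightarrow> 'a \<Rightarrow> ('a \<times> 'a) set" where
  "factorizations S \<Gamma> m a = {(b, c). b \<in> S \<and> c \<in> S \<and> (\<exists>\<beta>\<in>\<Gamma>. a = m b \<beta> c)}"

(* The case distinction is needed: Sup and Inf of the empty set of reals are not
   the bounds 0 and 1 of the unit interval. *)
definition ifs_prod ::
    "'a set \<Rightarrow> 'g set \<Rightarrow> ('a \<Rightarrow> 'g \<Rightarrow> 'a \<Rightarrow> 'a) \<Rightarrow> 'a ifs \<Rightarrow> 'a ifs \<Rightarrow> 'a ifs" where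
  "ifs_prod S \<Gamma> m A B =
    ((\<lambda>a. if factorizations S \<Gamma> m a \<noteq> {}
          then (SUP (b, c)\<in>factorizations S \<Gamma> m a. min (fst A b) (fst B c)) else 0),
     (\<lambda>a. if factorizations S \<Gamma> m a \<noteq> {}
          then (INF (b, c)\<in>factorizations S \<Gamma> m a. max (snd A b) (snd B c)) else 1))"

definition ifs_quasi_ideal ::
    "'a set \<Rightarrow> 'g set \<Rightarrow> ('a \<Rightarrow> 'g \<Rightarrow> 'a \<Rightarrow> 'a) \<Rightarrow> 'a ifs \<Rightarrow> bool" where
  "ifs_quasi_ideal S \<Gamma> m A \<longleftrightarrow> is_ifs S A \<and>
    ifs_subset S (ifs_inter (ifs_prod S \<Gamma> m A ifs_delta) (ifs_prod S \<Gamma> m ifs_delta A)) A"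

end

(* In an intra-regular AG**-groupoid every a satisfies both a = t a and a = a s. Indeed
   a = (x (a a)) y = (a (x a)) y = (y (x a)) a, so t = y (x a) is a left factor; squaring and
   using the paramedial law gives a a = (a a) (t t), and substituting this back,
   a = ((a a) w) y = (y w) (a a) = a ((y w) a) with w = x (t t). These two factorizations
   bound both products with delta from the side opposite to the quasi ideal inclusion. *)
theory Submission
  imports Defs
begin

text \<open>Pulling \<open>c\<close> to the front leaves \<open>a\<close> and \<open>d\<close> at
  the two ends of a left-nested product, where the left invertive law swaps them; \<open>c\<close>
  then moves back.\<close>

lemma (in gamma_AG_star_star_groupoid) paramedial:
  assumes "a \<in> S" "b \<in> S" "c \<in> S" "d \<in> S" "\<alpha> \<in> \<Gamma>" "\<beta> \<in> \<Gamma>" "\<gamma> \<in> \<Gamma>"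
  shows "m (m a \<alpha> b) \<beta> (m c \<gamma> d) = m (m d \<alpha> b) \<beta> (m c \<gamma> a)"
proof -
  have "m (m a \<alpha> b) \<beta> (m c \<gamma> d) = m c \<beta> (m (m a \<alpha> b) \<gamma> d)"
    using assms by (intro star_star closed)
  also have "m (m a \<alpha> b) \<gamma> d = m (m d \<alpha> b) \<gamma> a"
    using assms by (intro left_invertive)
  also have "m c \<beta> (m (m d \<alpha> b) \<gamma> a) = m (m d \<alpha> b) \<beta> (m c \<gamma> a)"
    using assms by (intro star_star closed)
  finally show ?thesis .
qed

lemma (in gamma_AG_star_star_groupoid) intra_regular_factorizations:
  assumes "intra_regular S \<Gamma> m" and a: "a \<in> S"
  shows "\<exists>t\<in>S. \<exists>s\<in>S. \<exists>\<gamma>\<in>\<Gamma>. a = m t \<gamma> a \<and> a = m a \<gamma> s"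
proof -
  from assms obtain x y \<alpha> \<beta> \<gamma> where xy: "x \<in> S" "y \<in> S"
    and G: "\<alpha> \<in> \<Gamma>" "\<beta> \<in> \<Gamma>" "\<gamma> \<in> \<Gamma>"
    and eq: "a = m (m x \<alpha> (m a \<beta> a)) \<gamma> y"
    unfolding intra_regular_def by meson
  \<comment> \<open>Both laws permute elements of \<open>S\<close> but leave each operator in its
    position. This dictates the operators chosen in \<open>t\<close> and \<open>w\<close>.\<close>
  define t where "t = m y \<alpha> (m x \<beta> a)"
  define w where "w = m x \<beta> (m t \<gamma> t)"
  have t: "t \<in> S" unfolding t_def by (intro closed xy G a)
  have w: "w \<in> S" unfolding w_def by (intro closed xy G t)
  have "a = m (m a \<alpha> (m x \<beta> a)) \<gamma> y"
    using eq star_star[OF xy(1) a a G(1,2)] by simp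
  also have "\<dots> = m t \<gamma> a"
    unfolding t_def by (intro left_invertive closed xy G a)
  finally have left: "a = m t \<gamma> a" .
  have "m a \<beta> a = m (m t \<gamma> a) \<beta> (m t \<gamma> a)"
    using left by simp
  \<comment> \<open>The paramedial law exchanges the outermost \<open>t\<close> and
    \<open>a\<close>, gathering equal factors.\<close>
  also have "\<dots> = m (m a \<gamma> a) \<beta> (m t \<gamma> t)"
    by (intro paramedial t a G)
  finally have "m x \<alpha> (m a \<beta> a) = m x \<alpha> (m (m a \<gamma> a) \<beta> (m t \<gamma> t))"
    by simp
  also have "\<dots> = m (m a \<gamma> a) \<alpha> w"
    unfolding w_def by (intro star_star closed xy t a G)
  finally have "a = m (m (m a \<gamma> a) \<alpha> w) \<gamma> y"
    using eq by simp
  also have "\<dots> = m (m y \<alpha> w) \<gamma> (m a \<gamma> a)"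
    by (intro left_invertive closed xy w a G)
  also have "\<dots> = m a \<gamma> (m (m y \<alpha> w) \<gamma> a)"
    by (intro star_star closed xy w a G)
  finally have right: "a = m a \<gamma> (m (m y \<alpha> w) \<gamma> a)" .
  have "m (m y \<alpha> w) \<gamma> a \<in> S" by (intro closed xy w a G)
  with left right t G show ?thesis by blast
qed

lemma is_ifs_delta: "is_ifs S ifs_delta"
  by (simp add: is_ifs_def ifs_delta_def)

text \<open>A supremum or infimum of reals bounds its members once the family is bounded. Here the
  values of \<open>A\<close> in [0,1] keep every minimum below 1 and every maximum above 0.\<close>

lemma ifs_prod_bounds:
  assumes A: "is_ifs S A" and B: "is_ifs S B"
    and bc: "(b, c) \<in> factorizations S \<Gamma> m a"
  shows "min (fst A b) (fst B c) \<le> fst (ifs_prod S \<Gamma> m A B) a" (is ?fst)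
    and "snd (ifs_prod S \<Gamma> m A B) a \<le> max (snd A b) (snd B c)" (is ?snd)
proof -
  let ?F = "factorizations S \<Gamma> m a"
  have ne: "?F \<noteq> {}" using bc by blast
  have "bdd_above ((\<lambda>(b, c). min (fst A b) (fst B c)) ` ?F)"
    using A by (intro bdd_aboveI2[where M = 1])
      (auto simp: factorizations_def is_ifs_def min_le_iff_disj)
  from cSUP_upper[OF bc this] show ?fst
    using ne by (simp add: ifs_prod_def)
  have "bdd_below ((\<lambda>(b, c). max (snd A b) (snd B c)) ` ?F)"
    using A by (intro bdd_belowI2[where m = 0])
      (auto simp: factorizations_def is_ifs_def le_max_iff_disj)
  from cINF_lower[OF this bc] show ?snd
    using ne by (simp add: ifs_prod_def)
qed

text \<open>The factorization a = a s controls the product with \<open>ifs_delta\<close> on the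
  right, and a = t a the one with \<open>ifs_delta\<close> on the left.\<close>

lemma (in gamma_AG_star_star_groupoid) ifs_subset_inter_prod_delta:
  assumes "intra_regular S \<Gamma> m" and A: "is_ifs S A"
  shows "ifs_subset S A
    (ifs_inter (ifs_prod S \<Gamma> m A ifs_delta) (ifs_prod S \<Gamma> m ifs_delta A))"
  unfolding ifs_subset_def
proof
  fix a assume a: "a \<in> S"
  with assms obtain t s \<gamma> where "t \<in> S" "s \<in> S" "\<gamma> \<in> \<Gamma>" "a = m t \<gamma> a" "a = m a \<gamma> s"
    using intra_regular_factorizations by blast
  with a have as: "(a, s) \<in> factorizations S \<Gamma> m a" and ta: "(t, a) \<in> factorizations S \<Gamma> m a"
    by (auto simp: factorizations_def)
  \<comment> \<open>With these bounds the constants 1 and 0 of \<open>ifs_delta\<close> are neutral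
    for min and max.\<close>
  have "fst A a \<le> 1" "0 \<le> snd A a"
    using A a by (auto simp: is_ifs_def)
  with ifs_prod_bounds[OF A is_ifs_delta as] ifs_prod_bounds[OF is_ifs_delta A ta]
  show "fst A a \<le> fst (ifs_inter (ifs_prod S \<Gamma> m A ifs_delta) (ifs_prod S \<Gamma> m ifs_delta A)) a \<and>
    snd (ifs_inter (ifs_prod S \<Gamma> m A ifs_delta) (ifs_prod S \<Gamma> m ifs_delta A)) a \<le> snd A a"
    by (simp add: ifs_inter_def ifs_delta_def)
qed

lemma ifs_eq_iff_subset: "ifs_eq S A B \<longleftrightarrow> ifs_subset S A B \<and> ifs_subset S B A"
  by (auto simp: ifs_eq_def ifs_subset_def intro: order.antisym)

theorem theorem4:
  fixes S :: "'a set" and \<Gamma> :: "'g set" and m :: "'a \<Rightarrow> 'g \<Rightarrow> 'a \<Rightarrow> 'a"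
    and A :: "'a ifs"
  assumes "gamma_AG_star_star_groupoid S \<Gamma> m"
    and "intra_regular S \<Gamma> m"
    and "is_ifs S A"
  shows "ifs_quasi_ideal S \<Gamma> m A \<longleftrightarrow>
    ifs_eq S (ifs_inter (ifs_prod S \<Gamma> m A ifs_delta) (ifs_prod S \<Gamma> m ifs_delta A)) A"
  \<comment> \<open>Equality splits into two inclusions: one is the quasi ideal condition, the other
    holds for every intuitionistic fuzzy set here.\<close>
  using gamma_AG_star_star_groupoid.ifs_subset_inter_prod_delta[OF assms] assms(3)
  by (simp add: ifs_quasi_ideal_def ifs_eq_iff_subset)

end
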